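(* Fix $d,N,L\in\mathbb{N}$ and $T>0$, let $V_1,\dots,V_d:\mathbb{R}^N\to\mathbb{R}^N$ be smooth vector fields, and suppose that for every fixed $m\le L$ the associated tree-like vector fields $$\{V_\tau ~|~ \tau\in\mathbb{T}_w,\ w\in\mathscr{W}_m\}$$ are linearly independent. Let $X:[0,T]\to\mathbb{R}^d$ be a Lipschitz continuous path, and for each $y\in\mathbb{R}^N$ let $Y^y:[0,T]\to\mathbb{R}^N$ denote the unique solution of the controlled differential equation $$Y_t=y+\sum_{i=1}^d\int_0^t V_i(Y_s)\,dX^i_s\qquad\text{for every }t\in[0,T].$$ Then the signature components of $S(X)$ up to order $L$ can be uniquely reconstructed from the collection of solutions $(Y^y)_{y\in\mathbb{R}^N}$. That is, if $X$ and $\tilde X$ are Lipschitz continuous paths $[0,T]\to\mathbb{R}^d$ whose associated solutions satisfy $Y^y_t=\tilde Y^y_t$ for all $y\in\mathbb{R}^N$ and all $t\in[0,T]$, then for every $m\le L$, every word $w\in\mathscr{W}_m$ and all $0\le s\le t\le T$ the iterated integrals $\int_{\Delta^m_{[s,t]}}dX^w_r$ and $\int_{\Delta^m_{[s,t]}}d\tilde X^w_r$ coincide.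
   Context: Words and signature. $\mathscr{W}_m$ is the set of words $w=(w_1,\dots,w_m)$ with letters $w_l\in\{1,\dots,d\}$. For a Lipschitz path $X=(X^1,\dots,X^d):[0,T]\to\mathbb{R}^d$ and $0\le s\le t\le T$, $$\int_{\Delta^m_{[s,t]}}dX^w_r:=\int_s^t\int_s^{r_m}\cdots\int_s^{r_2}dX^{w_1}_{r_1}\,dX^{w_2}_{r_2}\cdots dX^{w_m}_{r_m}.$$ The signature $S(X)$ is the two-parameter function $S(X)_{s,t}=1+\sum_{m\ge1}\sum_{w\in\mathscr{W}_m}\left(\int_{\Delta^m_{[s,t]}}dX_r^w\right)e_{w_1}\otimes\cdots\otimes e_{w_m}$ with values in the extended tensor algebra $T((\mathbb{R}^d))$, where $e_1,\dots,e_d$ is the standard basis of $\mathbb{R}^d$. Its $m$-th order component is the collection of the $m$-th order iterated integrals. Trees. For $w\in\mathscr{W}_m$, $\mathbb{T}_w$ is the set of letter-labelled recursive trees of order $m$ with letter labels $w$: rooted trees on the vertex set $\{1,\dots,m\}$ with root $1$, in which each vertex $l\ge2$ is attached by an edge to a parent vertex in $\{1,\dots,l-1\}$, and vertex $l$ carries the letter $w_l$. The order of the branches at a vertex is ignored. $\bullet_i$ is the one-vertex tree with letter $i$, and $[\tau_1\cdots\tau_k]_{\bullet_i}$ is the tree obtained by attaching the roots of $\tau_1,\dots,\tau_k$ to a new root with letter $i$. Tree-like vector fields. To each tree $\tau$ associate $V_\tau:\mathbb{R}^N\to\mathbb{R}^N$ recursively by $V_{\bullet_i}(x)=V_i(x)$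 and $$V_{[\tau_1\cdots\tau_k]_{\bullet_i}}(x)=\sum_{j_1,\dots,j_k=1}^N\frac{\partial^kV_i}{\partial x_{j_k}\cdots\partial x_{j_1}}(x)\cdot\pi_{j_1}(V_{\tau_1}(x))\cdots\pi_{j_k}(V_{\tau_k}(x)),$$ where $\pi_j:\mathbb{R}^N\to\mathbb{R}$ is the $j$-th coordinate projection. $V_\tau$ depends only on the underlying rooted tree with its letters, not on the numbering of the vertices. Linear independence of $\{V_\tau ~|~ \tau\in\mathbb{T}_w,\ w\in\mathscr{W}_m\}$ means linear independence over $\mathbb{R}$ of the family indexed by these trees, where trees (possibly belonging to different words) that are isomorphic as letter-labelled rooted trees (forgetting the numbering) are identified and counted once. Standing assumption: for every driving path considered and every $y\in\mathbb{R}^N$, the controlled differential equation has a unique solution on $[0,T]$. *)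

theory Defs
  imports "HOL-Analysis.Analysis"
begin

text \<open>
  The Riemann-Stieltjes integral of \<open>f\<close> against \<open>g\<close> over \<open>{a..b}\<close>, as the limit of the tagged sums
  when the mesh tends to zero. It exists for continuous \<open>f\<close> and Lipschitz \<open>g\<close>.
\<close>

definition has_rs_integral ::
    "(real \<Rightarrow> 'b::real_normed_vector) \<Rightarrow> (real \<Rightarrow> real) \<Rightarrow> real \<Rightarrow> real \<Rightarrow> 'b \<Rightarrow> bool" where
  "has_rs_integral f g a b I \<longleftrightarrow>
     (\<forall>e>0. \<exists>\<delta>>0. \<forall>p. p tagged_division_of {a..b} \<and> (\<forall>(x, K)\<in>p. diameter K < \<delta>) \<longrightarrow>
        norm ((\<Sum>(x, K)\<in>p. (g (Sup K) - g (Inf K)) *\<^sub>R f x) - I) < e)"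

lemma has_rs_integral_unique:
  assumes "has_rs_integral f g a b I" and "has_rs_integral f g a b J"
  shows "I = J"
proof (rule ccontr)
  assume "I \<noteq> J"
  define e where "e = norm (I - J) / 2"
  have "e > 0" using \<open>I \<noteq> J\<close> by (simp add: e_def)
  let ?S = "\<lambda>p. \<Sum>(x, K)\<in>p. (g (Sup K) - g (Inf K)) *\<^sub>R f x"
  obtain d1 where "d1 > 0" and d1: "\<And>p. p tagged_division_of {a..b} \<Longrightarrow>
      (\<forall>(x, K)\<in>p. diameter K < d1) \<Longrightarrow> norm (?S p - I) < e"
    using assms(1)[unfolded has_rs_integral_def, rule_format, OF \<open>e > 0\<close>] by auto
  obtain d2 where "d2 > 0" and d2: "\<And>p. p tagged_division_of {a..b} \<Longrightarrow>
      (\<forall>(x, K)\<in>p. diameter K < d2) \<Longrightarrow> norm (?S p - J) < e"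
    using assms(2)[unfolded has_rs_integral_def, rule_format, OF \<open>e > 0\<close>] by auto
  define d where "d = min d1 d2 / 3"
  have "d > 0" using \<open>d1 > 0\<close> \<open>d2 > 0\<close> by (simp add: d_def)
  then have "gauge (\<lambda>x::real. ball x d)" by (simp add: gauge_def)
  then obtain p where p: "p tagged_division_of {a..b}" "(\<lambda>x. ball x d) fine p"
    by (rule fine_division_exists_real)
  have small: "diameter K < min d1 d2" if "(x, K) \<in> p" for x K
  proof -
    have "K \<subseteq> ball x d" using p(2) that by (auto simp: fine_def)
    then have "diameter K \<le> diameter (ball x d)" by (intro diameter_subset) auto
    also have "\<dots> = 2 * d" using \<open>d > 0\<close> by simp
    also have "\<dots> < min d1 d2" using \<open>d > 0\<close> unfolding d_def by linarith
    finally show ?thesis .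
  qed
  have "norm (?S p - I) < e" by (rule d1[OF p(1)]) (use small in force)
  moreover have "norm (?S p - J) < e" by (rule d2[OF p(1)]) (use small in force)
  moreover have "norm (I - J) \<le> norm (?S p - I) + norm (?S p - J)"
    using norm_triangle_ineq4[of "?S p - J" "?S p - I"] by simp
  ultimately show False unfolding e_def by linarith
qed

definition rs_integral ::
    "real \<Rightarrow> real \<Rightarrow> (real \<Rightarrow> 'b::real_normed_vector) \<Rightarrow> (real \<Rightarrow> real) \<Rightarrow> 'b" where
  "rs_integral a b f g = (THE I. has_rs_integral f g a b I)"

text \<open>
  The outermost integration in the iterated integral belongs to the last letter of the word, so
  the recursion consumes the reversed word.
\<close>

primrec iterated_integral_rev ::
    "(real \<Rightarrow> real ^ 'd) \<Rightarrow> real \<Rightarrow> 'd list \<Rightarrow> real \<Rightarrow> real" where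
  "iterated_integral_rev X s [] t = 1"
| "iterated_integral_rev X s (i # u) t =
     rs_integral s t (\<lambda>r. iterated_integral_rev X s u r) (\<lambda>r. X r $ i)"

definition iterated_integral ::
    "(real \<Rightarrow> real ^ 'd) \<Rightarrow> 'd list \<Rightarrow> real \<Rightarrow> real \<Rightarrow> real" where
  "iterated_integral X w s t = iterated_integral_rev X s (rev w) t"

definition lipschitz_path :: "real \<Rightarrow> (real \<Rightarrow> real ^ 'd) \<Rightarrow> bool" where
  "lipschitz_path T X \<longleftrightarrow> (\<exists>C. C-lipschitz_on {0..T} X)"

definition partial_deriv ::
    "'n::finite \<Rightarrow> (real ^ 'n \<Rightarrow> real ^ 'n) \<Rightarrow> real ^ 'n \<Rightarrow> real ^ 'n" where
  "partial_deriv j f x = vector_derivative (\<lambda>h. f (x + h *\<^sub>R axis j 1)) (at 0)"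

text \<open>
  \<open>iterated_partial [j\<^sub>1, \<dots>, j\<^sub>k] f\<close> is the \<open>k\<close>-th order partial derivative of \<open>f\<close> in which the
  variable with index \<open>j\<^sub>1\<close> is differentiated first.
\<close>

definition iterated_partial ::
    "'n::finite list \<Rightarrow> (real ^ 'n \<Rightarrow> real ^ 'n) \<Rightarrow> real ^ 'n \<Rightarrow> real ^ 'n" where
  "iterated_partial js f = fold partial_deriv js f"

text \<open>
  Infinite differentiability: differentiability is meant in the total sense, so all iterated
  partial derivatives exist and are continuous.
\<close>

definition smooth_field :: "(real ^ 'n::finite \<Rightarrow> real ^ 'n) \<Rightarrow> bool" where
  "smooth_field f \<longleftrightarrow> (\<forall>js. iterated_partial js f differentiable_on UNIV)"

definition cde_solution ::
    "('d::finite \<Rightarrow> real ^ 'n::finite \<Rightarrow> real ^ 'n) \<Rightarrow> real \<Rightarrow> (real \<Rightarrow> real ^ 'd) \<Rightarrow> real ^ 'n \<Rightarrow>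
     (real \<Rightarrow> real ^ 'n) \<Rightarrow> bool" where
  "cde_solution V T X y Y \<longleftrightarrow>
     continuous_on {0..T} Y \<and>
     (\<forall>t\<in>{0..T}. \<exists>I. (\<forall>i. has_rs_integral (\<lambda>s. V i (Y s)) (\<lambda>s. X s $ i) 0 t (I i)) \<and>
                    Y t = y + (\<Sum>i\<in>UNIV. I i))"

text \<open>Solutions are compared on \<open>{0..T}\<close> only: values outside the time interval are immaterial.\<close>

definition cde_uniquely_solvable ::
    "('d::finite \<Rightarrow> real ^ 'n::finite \<Rightarrow> real ^ 'n) \<Rightarrow> real \<Rightarrow> (real \<Rightarrow> real ^ 'd) \<Rightarrow> real ^ 'n \<Rightarrow>
     bool" where
  "cde_uniquely_solvable V T X y \<longleftrightarrow>
     (\<exists>Y. cde_solution V T X y Y \<and>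
          (\<forall>Y'. cde_solution V T X y Y' \<longrightarrow> (\<forall>t\<in>{0..T}. Y' t = Y t)))"

text \<open>
  A recursive tree consists of the word \<open>w\<close> and the function that sends each non-root vertex
  \<open>l \<in> {2..length w}\<close> to its parent. Vertex \<open>l\<close> carries the letter \<open>w ! (l - 1)\<close>. Only
  nonempty words are meaningful, since a rooted tree has at least one vertex.
\<close>

type_synonym 'd recursive_tree = "'d list \<times> (nat \<Rightarrow> nat)"

definition recursive_trees :: "'d list \<Rightarrow> 'd recursive_tree set" where
  "recursive_trees w = {w} \<times> (\<Pi>\<^sub>E l\<in>{2..length w}. {1..<l})"

definition letter :: "'d recursive_tree \<Rightarrow> nat \<Rightarrow> 'd" where
  "letter \<tau> l = fst \<tau> ! (l - 1)"

definition parent :: "'d recursive_tree \<Rightarrow> nat \<Rightarrow> nat" where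
  "parent \<tau> = snd \<tau>"

definition tree_iso :: "'d recursive_tree \<Rightarrow> 'd recursive_tree \<Rightarrow> bool" where
  "tree_iso \<tau> \<tau>' \<longleftrightarrow>
     (\<exists>\<sigma>. bij_betw \<sigma> {1..length (fst \<tau>)} {1..length (fst \<tau>')} \<and> \<sigma> 1 = 1 \<and>
          (\<forall>l\<in>{1..length (fst \<tau>)}. letter \<tau>' (\<sigma> l) = letter \<tau> l) \<and>
          (\<forall>l\<in>{2..length (fst \<tau>)}. parent \<tau>' (\<sigma> l) = \<sigma> (parent \<tau> l)))"

text \<open>
  \<open>Node i [\<tau>\<^sub>1, \<dots>, \<tau>\<^sub>k]\<close> is the tree obtained by attaching \<open>\<tau>\<^sub>1, \<dots>, \<tau>\<^sub>k\<close> to a new root with letter \<open>i\<close>.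
  The listing of the branches only serves the recursion of \<open>tree_field\<close>; for smooth fields its
  result does not depend on it.
\<close>

datatype 'd tree = Node 'd "'d tree list"

text \<open>
  The index list \<open>js = [j\<^sub>1, \<dots>, j\<^sub>k]\<close> ranges over all \<open>k\<close>-tuples of coordinates. The case of the
  one-vertex tree is \<open>k = 0\<close>.
\<close>

function tree_field ::
    "('d \<Rightarrow> real ^ 'n::finite \<Rightarrow> real ^ 'n) \<Rightarrow> 'd tree \<Rightarrow> real ^ 'n \<Rightarrow> real ^ 'n" where
  "tree_field V (Node i ts) x =
     (\<Sum>js | length js = length ts.
        (\<Prod>l<length ts. tree_field V (ts ! l) x $ (js ! l)) *\<^sub>R iterated_partial js (V i) x)"
  by pat_completeness auto

termination
proof (relation "Wellfounded.measure (\<lambda>(V, \<tau>, x). size \<tau>)")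
  fix V :: "'d \<Rightarrow> real ^ 'n::finite \<Rightarrow> real ^ 'n" and i :: 'd and x js l
  fix ts :: "'d tree list"
  assume "l \<in> {..<length ts}"
  then have "size (ts ! l) \<le> size_list size ts"
    by (intro size_list_estimation'[of "ts ! l"]) auto
  then show "((V, ts ! l, x), (V, Node i ts, x)) \<in> Wellfounded.measure (\<lambda>(V, \<tau>, x). size \<tau>)"
    by simp
qed simp

lemma tree_field_single: "tree_field V (Node i []) = V i"
  by (rule ext) (simp add: iterated_partial_def)

function subtree_at :: "'d recursive_tree \<Rightarrow> nat \<Rightarrow> 'd tree" where
  "subtree_at \<tau> v =
     Node (letter \<tau> v)
       (map (subtree_at \<tau>) (filter (\<lambda>l. parent \<tau> l = v) [Suc v..<Suc (length (fst \<tau>))]))"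
  by pat_completeness auto

termination
  by (relation "Wellfounded.measure (\<lambda>(\<tau>, v). Suc (length (fst \<tau>)) - v)") auto

declare subtree_at.simps [simp del]

definition recursive_tree_field ::
    "('d \<Rightarrow> real ^ 'n::finite \<Rightarrow> real ^ 'n) \<Rightarrow> 'd recursive_tree \<Rightarrow> real ^ 'n \<Rightarrow> real ^ 'n" where
  "recursive_tree_field V \<tau> = tree_field V (subtree_at \<tau> 1)"

text \<open>
  Linear independence of the family of the \<open>V\<^sub>\<tau>\<close> that is indexed by the isomorphism classes of the
  trees with \<open>m\<close> vertices (over all words of length \<open>m\<close>): no set \<open>R\<close> that contains at most one tree
  from each class admits a nontrivial linear relation. Two non-isomorphic trees with the same
  vector field therefore violate the condition. Such an \<open>R\<close> is finite since there are only finitely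
  many letters.
\<close>

definition tree_fields_independent ::
    "('d::finite \<Rightarrow> real ^ 'n::finite \<Rightarrow> real ^ 'n) \<Rightarrow> nat \<Rightarrow> bool" where
  "tree_fields_independent V m \<longleftrightarrow>
     (\<forall>R c. R \<subseteq> (\<Union>w\<in>{w. length w = m}. recursive_trees w) \<and>
            pairwise (\<lambda>\<tau> \<tau>'. \<not> tree_iso \<tau> \<tau>') R \<and>
            (\<forall>x. (\<Sum>\<tau>\<in>R. c \<tau> *\<^sub>R recursive_tree_field V \<tau> x) = 0) \<longrightarrow>
            (\<forall>\<tau>\<in>R. c \<tau> = 0))"

end

theory Submission
  imports Defs
begin

text \<open>
  Independence at level one already forces the increments of the two paths to agree. Solving the
  time-reversed equation shows that every point \<open>z\<close> is attained at every time \<open>s\<close> by a solution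
  \<open>Y\<close>, which by assumption solves both equations. Expanding both at time \<open>s\<close> gives
  \<open>(\<Sum>i. (X - X')\<^sub>t\<^sup>i V\<^sub>i(z)) - (\<Sum>i. (X - X')\<^sub>s\<^sup>i V\<^sub>i(z)) = o(t - s)\<close>. So \<open>\<Sum>i. (X - X')\<^sup>i V\<^sub>i(z)\<close> is constant
  in time for each \<open>z\<close>, the linear independence of the \<open>V\<^sub>i\<close> makes \<open>X - X'\<close> constant, and iterated
  integrals only see increments.
\<close>

section \<open>Riemann-Stieltjes integrals and their primitives\<close>

lemma tagged_division_of_real_interval:
  fixes a b :: real
  assumes "p tagged_division_of {a..b}" and "(x, K) \<in> p"
  shows "x \<in> K" and "K = {Inf K..Sup K}" and "a \<le> Inf K" and "Inf K \<le> Sup K" and "Sup K \<le> b"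
proof -
  have "x \<in> K" "K \<subseteq> {a..b}" "\<exists>u v. K = cbox u v"
    using tagged_division_ofD(2-4)[OF assms] by auto
  then obtain u v where "K = {u..v}" by (metis box_real(2))
  then have "u \<le> v" using \<open>x \<in> K\<close> by auto
  then have "Inf K = u" "Sup K = v" using \<open>K = {u..v}\<close> by auto
  then show "x \<in> K" "K = {Inf K..Sup K}" "a \<le> Inf K" "Inf K \<le> Sup K" "Sup K \<le> b"
    using \<open>x \<in> K\<close> \<open>K \<subseteq> {a..b}\<close> \<open>K = {u..v}\<close> \<open>u \<le> v\<close> by auto
qed

lemma small_tagged_division_exists:
  fixes a b d :: real
  assumes "d > 0"
  obtains p where "p tagged_division_of {a..b}" "\<forall>(x, K)\<in>p. diameter K < d"
proof -
  \<comment> \<open>A cell inside a ball of radius \<open>d/3\<close> has diameter at most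
    \<open>2*d/3\<close>, which leaves room for the strict inequality.\<close>
  have "gauge (\<lambda>x::real. ball x (d/3))" using assms by (simp add: gauge_def)
  then obtain p where p: "p tagged_division_of {a..b}" "(\<lambda>x. ball x (d/3)) fine p"
    by (rule fine_division_exists_real)
  have "diameter K < d" if "(x, K) \<in> p" for x K
  proof -
    have "K \<subseteq> ball x (d/3)" using p(2) that by (auto simp: fine_def)
    then have "diameter K \<le> diameter (ball x (d/3))" by (intro diameter_subset) auto
    also have "\<dots> < d" using assms by simp
    finally show ?thesis .
  qed
  then show ?thesis using that p(1) by blast
qed

text \<open>Tagged sums evaluate \<open>f\<close> and \<open>g\<close> only inside
  \<open>{a..b}\<close>, and \<open>g\<close> only through increments. The freedom \<open>k\<close>
  is what finally makes a constant difference of two paths invisible.\<close>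

lemma has_rs_integral_cong:
  assumes "\<And>r. r \<in> {a..b} \<Longrightarrow> f r = f' r"
    and "\<And>r. r \<in> {a..b} \<Longrightarrow> g r = g' r + k"
  shows "has_rs_integral f g a b I = has_rs_integral f' g' a b I"
proof -
  have "(\<Sum>(x, K)\<in>p. (g (Sup K) - g (Inf K)) *\<^sub>R f x) =
        (\<Sum>(x, K)\<in>p. (g' (Sup K) - g' (Inf K)) *\<^sub>R f' x)"
    if p: "p tagged_division_of {a..b}" for p
  proof (intro sum.cong refl, clarify)
    fix x K assume xK: "(x, K) \<in> p"
    note K = tagged_division_of_real_interval[OF p xK]
    then have "x \<in> {Inf K..Sup K}" by simp
    then have "x \<in> {a..b}" "Inf K \<in> {a..b}" "Sup K \<in> {a..b}" using K(3-5) by auto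
    then show "(g (Sup K) - g (Inf K)) *\<^sub>R f x = (g' (Sup K) - g' (Inf K)) *\<^sub>R f' x"
      using assms by simp
  qed
  then show ?thesis unfolding has_rs_integral_def by (simp cong: conj_cong)
qed

lemma has_rs_integral_refl: "has_rs_integral f g a a 0"
proof -
  have "(\<Sum>(x, K)\<in>p. (g (Sup K) - g (Inf K)) *\<^sub>R f x) = 0"
    if p: "p tagged_division_of {a..a}" for p
  proof (intro sum.neutral ballI, clarify)
    fix x K assume "(x, K) \<in> p"
    from tagged_division_of_real_interval(3-5)[OF p this] have "Inf K = a" "Sup K = a" by auto
    then show "(g (Sup K) - g (Inf K)) *\<^sub>R f x = 0" by simp
  qed
  then show ?thesis unfolding has_rs_integral_def by (auto intro!: exI[of _ 1])
qed

text \<open>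
  A quantitative description of an indefinite integral of \<open>f\<close> against the \<open>C\<close>-Lipschitz function
  \<open>g\<close>. Unlike the limit of tagged sums it is stable under restriction, reversal and concatenation
  for trivial reasons.
\<close>

definition rs_primitive ::
    "real \<Rightarrow> (real \<Rightarrow> 'b::real_normed_vector) \<Rightarrow> (real \<Rightarrow> real) \<Rightarrow> real \<Rightarrow> real \<Rightarrow> (real \<Rightarrow> 'b) \<Rightarrow>
     bool" where
  "rs_primitive C f g a b F \<longleftrightarrow>
     (\<forall>u v c \<omega>. a \<le> u \<and> u \<le> v \<and> v \<le> b \<and> (\<forall>y\<in>{u..v}. norm (f y - c) \<le> \<omega>) \<longrightarrow>
        norm (F v - F u - (g v - g u) *\<^sub>R c) \<le> C * (v - u) * \<omega>)"

lemma rs_primitiveD: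
  assumes "rs_primitive C f g a b F" and "a \<le> u" "u \<le> v" "v \<le> b"
    and "\<And>y. u \<le> y \<Longrightarrow> y \<le> v \<Longrightarrow> norm (f y - c) \<le> \<omega>"
  shows "norm (F v - F u - (g v - g u) *\<^sub>R c) \<le> C * (v - u) * \<omega>"
proof -
  have "\<forall>y\<in>{u..v}. norm (f y - c) \<le> \<omega>" using assms(5) by simp
  then show ?thesis using assms(1-4) unfolding rs_primitive_def by blast
qed

text \<open>On a fine cell, \<open>f\<close> stays within \<open>\<epsilon>\<close> of its value at
  the tag, by uniform continuity. Taking that value as the constant \<open>c\<close> of the
  primitive, the cell errors add up to at most \<open>C * (b - a) * \<epsilon>\<close>.\<close>

lemma rs_primitive_has_rs_integral:
  assumes F: "rs_primitive C f g a b F" and f: "continuous_on {a..b} f" and "a \<le> b" "0 \<le> C"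
  shows "has_rs_integral f g a b (F b - F a)"
  unfolding has_rs_integral_def
proof (intro allI impI)
  fix e :: real assume "e > 0"
  \<comment> \<open>Chosen so that the total error is at most \<open>e / 2\<close>; the summand 1
    keeps the denominator positive when \<open>C\<close> or \<open>b - a\<close> vanishes.\<close>
  define \<epsilon> where "\<epsilon> = e / (2 * (C * (b - a) + 1))"
  have pos: "C * (b - a) + 1 > 0" using assms by (simp add: add_nonneg_pos)
  then have "\<epsilon> > 0" using \<open>e > 0\<close> by (simp add: \<epsilon>_def)
  have "uniformly_continuous_on {a..b} f" by (simp add: f compact_uniformly_continuous)
  then obtain d where "d > 0" and
    d: "\<And>x y. x \<in> {a..b} \<Longrightarrow> y \<in> {a..b} \<Longrightarrow> dist y x < d \<Longrightarrow> dist (f y) (f x) < \<epsilon>"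
    using \<open>\<epsilon> > 0\<close> unfolding uniformly_continuous_on_def by metis
  have "norm ((\<Sum>(x, K)\<in>p. (g (Sup K) - g (Inf K)) *\<^sub>R f x) - (F b - F a)) < e"
    if p: "p tagged_division_of {a..b}" "\<forall>(x, K)\<in>p. diameter K < d" for p
  proof -
    have "norm (case xK of (x, K) \<Rightarrow> (F (Sup K) - F (Inf K)) - (g (Sup K) - g (Inf K)) *\<^sub>R f x)
          \<le> (case xK of (x, K) \<Rightarrow> C * (Sup K - Inf K) * \<epsilon>)"
      if xKp: "xK \<in> p" for xK
    proof (cases xK)
      case (Pair x K)
      with xKp have xK: "(x, K) \<in> p" by simp
      note K = tagged_division_of_real_interval[OF p(1) xK]
      have "norm (f y - f x) \<le> \<epsilon>" if "Inf K \<le> y" "y \<le> Sup K" for y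
      proof -
        have "y \<in> K" using that by (subst K(2)) simp
        have "x \<in> {Inf K..Sup K}" using K(1,2) by simp
        have "bounded K" by (subst K(2)) (rule bounded_closed_interval)
        then have "dist y x \<le> diameter K"
          using \<open>y \<in> K\<close> K(1) by (intro diameter_bounded_bound)
        moreover have "diameter K < d" using p(2) xK by blast
        ultimately have "dist (f y) (f x) < \<epsilon>"
          using K(3-5) that \<open>x \<in> {Inf K..Sup K}\<close> by (intro d) auto
        then show ?thesis by (simp add: dist_norm)
      qed
      then show ?thesis
        unfolding Pair prod.case using K(3-5) by (intro rs_primitiveD[OF F]) auto
    qed
    then have "norm (\<Sum>xK\<in>p. case xK of (x, K) \<Rightarrow>
        (F (Sup K) - F (Inf K)) - (g (Sup K) - g (Inf K)) *\<^sub>R f x)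
        \<le> (\<Sum>xK\<in>p. case xK of (x, K) \<Rightarrow> C * (Sup K - Inf K) * \<epsilon>)"
      by (intro sum_norm_le)
    also have "\<dots> = C * \<epsilon> * (\<Sum>(x, K)\<in>p. Sup K - Inf K)"
      by (simp add: sum_distrib_left case_prod_unfold mult_ac)
    also have "(\<Sum>(x, K)\<in>p. Sup K - Inf K) = b - a"
      using additive_tagged_division_1[OF \<open>a \<le> b\<close> p(1), of "\<lambda>x. x"] by simp
    also have "C * \<epsilon> * (b - a) \<le> (C * (b - a) + 1) * \<epsilon>"
      using \<open>\<epsilon> > 0\<close> by (simp add: algebra_simps)
    also have "\<dots> = e / 2" using pos unfolding \<epsilon>_def
      by (metis nonzero_mult_divide_mult_cancel_left2 times_divide_eq_right less_irrefl)
    also have "\<dots> < e" using \<open>e > 0\<close> by simp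
    also have "(\<Sum>xK\<in>p. case xK of (x, K) \<Rightarrow>
        (F (Sup K) - F (Inf K)) - (g (Sup K) - g (Inf K)) *\<^sub>R f x)
        = (F b - F a) - (\<Sum>(x, K)\<in>p. (g (Sup K) - g (Inf K)) *\<^sub>R f x)"
      unfolding additive_tagged_division_1[OF \<open>a \<le> b\<close> p(1), symmetric]
      by (simp add: case_prod_unfold sum_subtractf)
    finally show ?thesis by (simp add: norm_minus_commute)
  qed
  then show "\<exists>\<delta>>0. \<forall>p. p tagged_division_of {a..b} \<and> (\<forall>(x, K)\<in>p. diameter K < \<delta>) \<longrightarrow>
      norm ((\<Sum>(x, K)\<in>p. (g (Sup K) - g (Inf K)) *\<^sub>R f x) - (F b - F a)) < e"
    using \<open>d > 0\<close> by blast
qed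

text \<open>Appending a fine division of \<open>{u..v}\<close> to one of \<open>{a..u}\<close> gives
  a fine division of \<open>{a..v}\<close>. Hence \<open>F v - F u\<close> is approximated by the
  tagged sum over \<open>{u..v}\<close> alone, where replacing \<open>f x\<close> by
  \<open>c\<close> costs at most \<open>C * \<omega>\<close> times the length of each cell.\<close>

lemma has_rs_integral_rs_primitive:
  assumes F: "\<And>t. t \<in> {a..b} \<Longrightarrow> has_rs_integral f g a t (F t)"
    and g: "\<And>u v. a \<le> u \<Longrightarrow> u \<le> v \<Longrightarrow> v \<le> b \<Longrightarrow> \<bar>g v - g u\<bar> \<le> C * (v - u)"
  shows "rs_primitive C f g a b F"
  unfolding rs_primitive_def
proof (intro allI impI, elim conjE)
  fix u v c \<omega>
  assume uv: "a \<le> u" "u \<le> v" "v \<le> b" and \<omega>: "\<forall>y\<in>{u..v}. norm (f y - c) \<le> \<omega>"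
  let ?S = "\<lambda>p. \<Sum>(x, K)\<in>p. (g (Sup K) - g (Inf K)) *\<^sub>R f x"
  show "norm (F v - F u - (g v - g u) *\<^sub>R c) \<le> C * (v - u) * \<omega>"
  proof (rule field_le_epsilon)
    fix e :: real assume "e > 0"
    then have e2: "e / 2 > 0" by simp
    obtain d1 where "d1 > 0" and d1: "\<And>p. p tagged_division_of {a..u} \<Longrightarrow>
        (\<forall>(x, K)\<in>p. diameter K < d1) \<Longrightarrow> norm (?S p - F u) < e / 2"
      using F[of u, unfolded has_rs_integral_def, rule_format, OF _ e2] uv by auto
    obtain d2 where "d2 > 0" and d2: "\<And>p. p tagged_division_of {a..v} \<Longrightarrow>
        (\<forall>(x, K)\<in>p. diameter K < d2) \<Longrightarrow> norm (?S p - F v) < e / 2"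
      using F[of v, unfolded has_rs_integral_def, rule_format, OF _ e2] uv by auto
    have d: "min d1 d2 > 0" using \<open>d1 > 0\<close> \<open>d2 > 0\<close> by simp
    obtain p where p: "p tagged_division_of {a..u}" "\<forall>(x, K)\<in>p. diameter K < min d1 d2"
      using small_tagged_division_exists[OF d] .
    obtain q where q: "q tagged_division_of {u..v}" "\<forall>(x, K)\<in>q. diameter K < min d1 d2"
      using small_tagged_division_exists[OF d] .
    have pq: "p \<union> q tagged_division_of {a..v}"
    proof -
      have "interior {a..u} \<inter> interior {u..v} = {}" by auto
      from tagged_division_Un[OF p(1) q(1) this] uv show ?thesis
        by (simp add: ivl_disj_un_two_touch)
    qed
    \<comment> \<open>The two divisions may share a tagged cell, but only the degenerate one at
      \<open>u\<close>, where the increment of \<open>g\<close> is zero.\<close>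
    have S: "?S (p \<union> q) = ?S p + ?S q"
    proof (rule sum.union_inter_neutral)
      show "finite p" "finite q" using p q by auto
      show "\<forall>xK\<in>p \<inter> q. (case xK of (x, K) \<Rightarrow> (g (Sup K) - g (Inf K)) *\<^sub>R f x) = 0"
      proof (intro ballI, clarify)
        fix x K assume "(x, K) \<in> p" "(x, K) \<in> q"
        from tagged_division_of_real_interval(4,5)[OF p(1) this(1)]
          tagged_division_of_real_interval(3)[OF q(1) this(2)]
        have "Inf K = Sup K" by linarith
        then show "(g (Sup K) - g (Inf K)) *\<^sub>R f x = 0" by simp
      qed
    qed
    moreover have "norm (?S p - F u) < e / 2" using p by (intro d1) auto
    moreover have "norm (?S (p \<union> q) - F v) < e / 2" using p q by (intro d2[OF pq]) auto
    moreover have "norm (?S q - (g v - g u) *\<^sub>R c) \<le> C * (v - u) * \<omega>"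
    proof -
      have "?S q - (g v - g u) *\<^sub>R c
          = (\<Sum>xK\<in>q. case xK of (x, K) \<Rightarrow> (g (Sup K) - g (Inf K)) *\<^sub>R (f x - c))"
        unfolding additive_tagged_division_1[OF \<open>u \<le> v\<close> q(1), of g, symmetric]
        by (simp add: case_prod_unfold sum_subtractf[symmetric] scaleR_diff_right scaleR_sum_left)
      also have "norm \<dots> \<le> (\<Sum>xK\<in>q. case xK of (x, K) \<Rightarrow> C * (Sup K - Inf K) * \<omega>)"
      proof (rule sum_norm_le)
        fix xK assume "xK \<in> q"
        moreover obtain x K where "xK = (x, K)" by fastforce
        ultimately have xK: "(x, K) \<in> q" "xK = (x, K)" by auto
        note K = tagged_division_of_real_interval[OF q(1) xK(1)]
        have "\<bar>g (Sup K) - g (Inf K)\<bar> \<le> C * (Sup K - Inf K)"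
          using K(3-5) uv by (intro g) auto
        moreover have "x \<in> {Inf K..Sup K}" using K(1,2) by simp
        then have "norm (f x - c) \<le> \<omega>" using \<omega> K(3-5) by auto
        ultimately show "norm (case xK of (x, K) \<Rightarrow> (g (Sup K) - g (Inf K)) *\<^sub>R (f x - c))
            \<le> (case xK of (x, K) \<Rightarrow> C * (Sup K - Inf K) * \<omega>)"
          unfolding xK by (simp add: mult_mono')
      qed
      also have "\<dots> = C * \<omega> * (\<Sum>(x, K)\<in>q. Sup K - Inf K)"
        by (simp add: sum_distrib_left case_prod_unfold mult_ac)
      also have "(\<Sum>(x, K)\<in>q. Sup K - Inf K) = v - u"
        using additive_tagged_division_1[OF \<open>u \<le> v\<close> q(1), of "\<lambda>x. x"] by simp
      finally show ?thesis by (simp add: mult_ac)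
    qed
    moreover have eq: "F v - F u - (g v - g u) *\<^sub>R c = (?S q - (g v - g u) *\<^sub>R c) + (?S p - F u)
        - (?S (p \<union> q) - F v)"
      unfolding S by simp
    ultimately show "norm (F v - F u - (g v - g u) *\<^sub>R c) \<le> C * (v - u) * \<omega> + e"
      unfolding eq
      using norm_triangle_ineq4[of "(?S q - (g v - g u) *\<^sub>R c) + (?S p - F u)" "?S (p \<union> q) - F v"]
        norm_triangle_ineq[of "?S q - (g v - g u) *\<^sub>R c" "?S p - F u"]
      by linarith
  qed
qed

section \<open>Restriction, time change and gluing of primitives\<close>

lemma rs_primitive_subset:
  assumes "rs_primitive C f g a b F" and "a \<le> a'" "b' \<le> b"
  shows "rs_primitive C f g a' b' F"
  using assms unfolding rs_primitive_def by (meson order_trans)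

text \<open>Only increments of the primitive enter; the constant \<open>k\<close> allows primitives
  on adjacent intervals to be matched at the common endpoint.\<close>

lemma rs_primitive_cong:
  assumes F: "rs_primitive C f g a b F"
    and eq: "\<And>r. r \<in> {a..b} \<Longrightarrow> f' r = f r" "\<And>r. r \<in> {a..b} \<Longrightarrow> g' r = g r"
      "\<And>r. r \<in> {a..b} \<Longrightarrow> F' r = F r + k"
  shows "rs_primitive C f' g' a b F'"
  unfolding rs_primitive_def
proof (intro allI impI, elim conjE)
  fix u v c \<omega>
  assume uv: "a \<le> u" "u \<le> v" "v \<le> b" and \<omega>: "\<forall>y\<in>{u..v}. norm (f' y - c) \<le> \<omega>"
  have "norm (F v - F u - (g v - g u) *\<^sub>R c) \<le> C * (v - u) * \<omega>"
    using uv \<omega> eq(1) by (intro rs_primitiveD[OF F]) force+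
  then show "norm (F' v - F' u - (g' v - g' u) *\<^sub>R c) \<le> C * (v - u) * \<omega>"
    using uv eq by simp
qed

lemma rs_primitive_shift:
  assumes F: "rs_primitive C f g a b F"
  shows "rs_primitive C (\<lambda>r. f (r - s)) (\<lambda>r. g (r - s)) (a + s) (b + s) (\<lambda>r. F (r - s))"
  unfolding rs_primitive_def
proof (intro allI impI, elim conjE)
  fix u v c \<omega>
  assume uv: "a + s \<le> u" "u \<le> v" "v \<le> b + s" and \<omega>: "\<forall>y\<in>{u..v}. norm (f (y - s) - c) \<le> \<omega>"
  have "norm (f y - c) \<le> \<omega>" if "u - s \<le> y" "y \<le> v - s" for y
    using \<omega>[rule_format, of "y + s"] that by simp
  then have "norm (F (v - s) - F (u - s) - (g (v - s) - g (u - s)) *\<^sub>R c)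
      \<le> C * ((v - s) - (u - s)) * \<omega>"
    using uv by (intro rs_primitiveD[OF F]) auto
  then show "norm (F (v - s) - F (u - s) - (g (v - s) - g (u - s)) *\<^sub>R c) \<le> C * (v - u) * \<omega>"
    by simp
qed

lemma rs_primitive_reverse:
  assumes F: "rs_primitive C f g a b F"
  shows "rs_primitive C (\<lambda>r. f (s - r)) (\<lambda>r. g (s - r)) (s - b) (s - a) (\<lambda>r. F (s - r))"
  unfolding rs_primitive_def
proof (intro allI impI, elim conjE)
  fix u v c \<omega>
  assume uv: "s - b \<le> u" "u \<le> v" "v \<le> s - a" and \<omega>: "\<forall>y\<in>{u..v}. norm (f (s - y) - c) \<le> \<omega>"
  have "norm (f y - c) \<le> \<omega>" if "s - v \<le> y" "y \<le> s - u" for y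
    using \<omega>[rule_format, of "s - y"] that by simp
  then have "norm (F (s - u) - F (s - v) - (g (s - u) - g (s - v)) *\<^sub>R c)
      \<le> C * ((s - u) - (s - v)) * \<omega>"
    using uv by (intro rs_primitiveD[OF F]) auto
  \<comment> \<open>Reversal exchanges the endpoints and so changes the sign of both increments at
    once; the norm does not notice.\<close>
  moreover have "F (s - v) - F (s - u) - (g (s - v) - g (s - u)) *\<^sub>R c
      = - (F (s - u) - F (s - v) - (g (s - u) - g (s - v)) *\<^sub>R c)"
    by (simp add: algebra_simps)
  ultimately show "norm (F (s - v) - F (s - u) - (g (s - v) - g (s - u)) *\<^sub>R c) \<le> C * (v - u) * \<omega>"
    by (simp only: norm_minus_cancel) simp
qed

text \<open>The same \<open>c\<close> and \<open>\<omega>\<close> serve on both sides of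
  \<open>s\<close>, and the bound is additive in the length of the interval, so splitting at
  \<open>s\<close> loses nothing.\<close>

lemma rs_primitive_join:
  assumes F1: "rs_primitive C f g a s F" and F2: "rs_primitive C f g s b F"
  shows "rs_primitive C f g a b F"
  unfolding rs_primitive_def
proof (intro allI impI, elim conjE)
  fix u v c \<omega>
  assume uv: "a \<le> u" "u \<le> v" "v \<le> b" and \<omega>: "\<forall>y\<in>{u..v}. norm (f y - c) \<le> \<omega>"
  consider "v \<le> s" | "s \<le> u" | "u \<le> s" "s \<le> v" by linarith
  then show "norm (F v - F u - (g v - g u) *\<^sub>R c) \<le> C * (v - u) * \<omega>"
  proof cases
    case 1
    then show ?thesis using uv \<omega> by (intro rs_primitiveD[OF F1]) auto
  next
    case 2
    then show ?thesis using uv \<omega> by (intro rs_primitiveD[OF F2]) auto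
  next
    case 3
    have "norm (F s - F u - (g s - g u) *\<^sub>R c) \<le> C * (s - u) * \<omega>"
      using uv \<omega> 3 by (intro rs_primitiveD[OF F1]) auto
    moreover have "norm (F v - F s - (g v - g s) *\<^sub>R c) \<le> C * (v - s) * \<omega>"
      using uv \<omega> 3 by (intro rs_primitiveD[OF F2]) auto
    moreover have "F v - F u - (g v - g u) *\<^sub>R c
        = (F s - F u - (g s - g u) *\<^sub>R c) + (F v - F s - (g v - g s) *\<^sub>R c)"
      by (simp add: algebra_simps)
    ultimately have "norm (F v - F u - (g v - g u) *\<^sub>R c) \<le> C * (s - u) * \<omega> + C * (v - s) * \<omega>"
      by (metis (no_types, lifting) norm_triangle_mono)
    then show ?thesis by (simp add: algebra_simps)
  qed
qed

section \<open>Solutions through prescribed points\<close>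

text \<open>
  \<open>C\<close> stands for a Lipschitz constant of \<open>X\<close>; only increments enter, so that no point of the
  interval is distinguished as the initial time.
\<close>

definition cde_path ::
    "('d::finite \<Rightarrow> real ^ 'n::finite \<Rightarrow> real ^ 'n) \<Rightarrow> real \<Rightarrow> (real \<Rightarrow> real ^ 'd) \<Rightarrow> real \<Rightarrow> real \<Rightarrow>
     (real \<Rightarrow> real ^ 'n) \<Rightarrow> bool" where
  "cde_path V C X a b Y \<longleftrightarrow> continuous_on {a..b} Y \<and>
     (\<exists>F. (\<forall>i. rs_primitive C (\<lambda>r. V i (Y r)) (\<lambda>r. X r $ i) a b (F i)) \<and>
          (\<forall>u\<in>{a..b}. \<forall>v\<in>{a..b}. Y v - Y u = (\<Sum>i\<in>UNIV. F i v - F i u)))"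

text \<open>Translates between integrals anchored at time 0 and a form that can be reversed, shifted
  and glued. The integrals over \<open>{0..t}\<close>, as functions of \<open>t\<close>, are the
  primitives; conversely a primitive restricted to \<open>{0..t}\<close> yields the
  integral.\<close>

lemma cde_solution_iff_cde_path:
  assumes X: "C-lipschitz_on {0..T} X" and V: "\<And>i. continuous_on UNIV (V i)" and "0 \<le> T"
  shows "cde_solution V T X y Y \<longleftrightarrow> cde_path V C X 0 T Y \<and> Y 0 = y"
proof
  assume sol: "cde_solution V T X y Y"
  then have "\<forall>t\<in>{0..T}. \<exists>I. (\<forall>i. has_rs_integral (\<lambda>s. V i (Y s)) (\<lambda>s. X s $ i) 0 t (I i)) \<and>
      Y t = y + (\<Sum>i\<in>UNIV. I i)"
    by (simp add: cde_solution_def)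
  then obtain G where
    G: "\<And>t i. t \<in> {0..T} \<Longrightarrow> has_rs_integral (\<lambda>s. V i (Y s)) (\<lambda>s. X s $ i) 0 t (G t i)"
    and Y: "\<And>t. t \<in> {0..T} \<Longrightarrow> Y t = y + (\<Sum>i\<in>UNIV. G t i)"
    by metis
  have "\<bar>X v $ i - X u $ i\<bar> \<le> C * (v - u)" if "0 \<le> u" "u \<le> v" "v \<le> T" for u v i
  proof -
    have "\<bar>X v $ i - X u $ i\<bar> \<le> dist (X v) (X u)"
      using component_le_norm_cart[of "X v - X u" i] by (simp add: dist_norm)
    also have "\<dots> \<le> C * dist v u" using that by (intro lipschitz_onD[OF X]) auto
    finally show ?thesis using that by (simp add: dist_real_def)
  qed
  then have "rs_primitive C (\<lambda>r. V i (Y r)) (\<lambda>r. X r $ i) 0 T (\<lambda>t. G t i)" for i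
    using G by (intro has_rs_integral_rs_primitive) auto
  moreover have "Y v - Y u = (\<Sum>i\<in>UNIV. G v i - G u i)" if "u \<in> {0..T}" "v \<in> {0..T}" for u v
    using Y that by (simp add: sum_subtractf)
  \<comment> \<open>The integral over the degenerate interval is 0, which pins down the initial
    value.\<close>
  moreover have "G 0 i = 0" for i
    using has_rs_integral_unique[OF G has_rs_integral_refl] \<open>0 \<le> T\<close> by simp
  then have "Y 0 = y" using Y[of 0] \<open>0 \<le> T\<close> by simp
  moreover have "continuous_on {0..T} Y" using sol by (simp add: cde_solution_def)
  ultimately show "cde_path V C X 0 T Y \<and> Y 0 = y"
    unfolding cde_path_def by (intro conjI exI[of _ "\<lambda>i t. G t i"]) auto
next
  assume "cde_path V C X 0 T Y \<and> Y 0 = y"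
  then obtain F where cont: "continuous_on {0..T} Y"
    and F: "\<And>i. rs_primitive C (\<lambda>r. V i (Y r)) (\<lambda>r. X r $ i) 0 T (F i)"
    and Y: "\<And>u v. u \<in> {0..T} \<Longrightarrow> v \<in> {0..T} \<Longrightarrow> Y v - Y u = (\<Sum>i\<in>UNIV. F i v - F i u)"
    and y: "Y 0 = y"
    unfolding cde_path_def by blast
  have "C \<ge> 0" using X by (rule lipschitz_on_nonneg)
  have "has_rs_integral (\<lambda>s. V i (Y s)) (\<lambda>s. X s $ i) 0 t (F i t - F i 0)"
    if "t \<in> {0..T}" for i t
  proof (rule rs_primitive_has_rs_integral)
    show "rs_primitive C (\<lambda>s. V i (Y s)) (\<lambda>s. X s $ i) 0 t (F i)"
      using rs_primitive_subset[OF F] that by simp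
    show "continuous_on {0..t} (\<lambda>s. V i (Y s))"
      using that by (intro continuous_on_compose2[OF V] continuous_on_subset[OF cont]) auto
  qed (use that \<open>C \<ge> 0\<close> in auto)
  moreover have "Y t = y + (\<Sum>i\<in>UNIV. F i t - F i 0)" if "t \<in> {0..T}" for t
    using Y[of 0 t] that y by (simp add: algebra_simps)
  ultimately show "cde_solution V T X y Y"
    unfolding cde_solution_def
    by (intro conjI ballI exI[of _ "\<lambda>i. F i _ - F i 0"] allI cont)
qed

section \<open>Restriction, time change and gluing of solutions\<close>

lemma cde_path_subset:
  assumes "cde_path V C X a b Y" and "a \<le> a'" "b' \<le> b"
  shows "cde_path V C X a' b' Y"
proof -
  have "{a'..b'} \<subseteq> {a..b}" using assms by auto
  obtain F where F: "continuous_on {a..b} Y"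
    "\<And>i. rs_primitive C (\<lambda>r. V i (Y r)) (\<lambda>r. X r $ i) a b (F i)"
    "\<And>u v. u \<in> {a..b} \<Longrightarrow> v \<in> {a..b} \<Longrightarrow> Y v - Y u = (\<Sum>i\<in>UNIV. F i v - F i u)"
    using assms(1) unfolding cde_path_def by blast
  have "continuous_on {a'..b'} Y" using F(1) \<open>{a'..b'} \<subseteq> {a..b}\<close> by (rule continuous_on_subset)
  moreover have "rs_primitive C (\<lambda>r. V i (Y r)) (\<lambda>r. X r $ i) a' b' (F i)" for i
    using F(2) assms(2,3) by (rule rs_primitive_subset)
  ultimately show ?thesis
    unfolding cde_path_def using F(3) \<open>{a'..b'} \<subseteq> {a..b}\<close> by (intro conjI exI[of _ F]) auto
qed

lemma cde_path_cong:
  assumes "cde_path V C X a b Y"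
    and "\<And>r. r \<in> {a..b} \<Longrightarrow> X' r = X r" "\<And>r. r \<in> {a..b} \<Longrightarrow> Y' r = Y r"
  shows "cde_path V C X' a b Y'"
proof -
  obtain F where F: "continuous_on {a..b} Y"
    "\<And>i. rs_primitive C (\<lambda>r. V i (Y r)) (\<lambda>r. X r $ i) a b (F i)"
    "\<And>u v. u \<in> {a..b} \<Longrightarrow> v \<in> {a..b} \<Longrightarrow> Y v - Y u = (\<Sum>i\<in>UNIV. F i v - F i u)"
    using assms(1) unfolding cde_path_def by blast
  have "rs_primitive C (\<lambda>r. V i (Y' r)) (\<lambda>r. X' r $ i) a b (F i)" for i
    using assms by (intro rs_primitive_cong[OF F(2), where k = 0]) auto
  moreover have "continuous_on {a..b} Y'"
    using F(1) assms(3) by (metis (no_types, lifting) continuous_on_cong)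
  ultimately show ?thesis unfolding cde_path_def using F(3) assms(3) by auto
qed

lemma cde_path_shift:
  assumes "cde_path V C X a b Y"
  shows "cde_path V C (\<lambda>r. X (r - s)) (a + s) (b + s) (\<lambda>r. Y (r - s))"
proof -
  obtain F where F: "continuous_on {a..b} Y"
    "\<And>i. rs_primitive C (\<lambda>r. V i (Y r)) (\<lambda>r. X r $ i) a b (F i)"
    "\<And>u v. u \<in> {a..b} \<Longrightarrow> v \<in> {a..b} \<Longrightarrow> Y v - Y u = (\<Sum>i\<in>UNIV. F i v - F i u)"
    using assms(1) unfolding cde_path_def by blast
  show ?thesis
    unfolding cde_path_def
  proof (intro conjI exI[of _ "\<lambda>i r. F i (r - s)"] allI ballI)
    show "continuous_on {a + s..b + s} (\<lambda>r. Y (r - s))"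
      by (intro continuous_on_compose2[OF F(1)] continuous_intros) auto
    show "rs_primitive C (\<lambda>r. V i (Y (r - s))) (\<lambda>r. X (r - s) $ i) (a + s) (b + s)
        (\<lambda>r. F i (r - s))" for i
      by (rule rs_primitive_shift[OF F(2)])
  qed (rule F(3); simp add: algebra_simps)
qed

lemma cde_path_reverse:
  assumes "cde_path V C X a b Y"
  shows "cde_path V C (\<lambda>r. X (s - r)) (s - b) (s - a) (\<lambda>r. Y (s - r))"
proof -
  obtain F where F: "continuous_on {a..b} Y"
    "\<And>i. rs_primitive C (\<lambda>r. V i (Y r)) (\<lambda>r. X r $ i) a b (F i)"
    "\<And>u v. u \<in> {a..b} \<Longrightarrow> v \<in> {a..b} \<Longrightarrow> Y v - Y u = (\<Sum>i\<in>UNIV. F i v - F i u)"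
    using assms(1) unfolding cde_path_def by blast
  show ?thesis
    unfolding cde_path_def
  proof (intro conjI exI[of _ "\<lambda>i r. F i (s - r)"] allI ballI)
    show "continuous_on {s - b..s - a} (\<lambda>r. Y (s - r))"
      by (intro continuous_on_compose2[OF F(1)] continuous_intros) auto
    show "rs_primitive C (\<lambda>r. V i (Y (s - r))) (\<lambda>r. X (s - r) $ i) (s - b) (s - a)
        (\<lambda>r. F i (s - r))" for i
      by (rule rs_primitive_reverse[OF F(2)])
  qed (rule F(3); simp add: algebra_simps)
qed

lemma cde_path_join:
  assumes Y1: "cde_path V C X a s Y1" and Y2: "cde_path V C X s b Y2"
    and s: "a \<le> s" "s \<le> b" "Y1 s = Y2 s"
  shows "cde_path V C X a b (\<lambda>r. if r \<le> s then Y1 r else Y2 r)" (is "cde_path V C X a b ?Y")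
proof -
  have Y1': "cde_path V C X a s ?Y" by (rule cde_path_cong[OF Y1]) auto
  have Y2': "cde_path V C X s b ?Y" by (rule cde_path_cong[OF Y2]) (use s in auto)
  obtain F where F: "continuous_on {a..s} ?Y"
    "\<And>i. rs_primitive C (\<lambda>r. V i (?Y r)) (\<lambda>r. X r $ i) a s (F i)"
    "\<And>u v. u \<in> {a..s} \<Longrightarrow> v \<in> {a..s} \<Longrightarrow> ?Y v - ?Y u = (\<Sum>i\<in>UNIV. F i v - F i u)"
    using Y1' unfolding cde_path_def by blast
  obtain G where G: "continuous_on {s..b} ?Y"
    "\<And>i. rs_primitive C (\<lambda>r. V i (?Y r)) (\<lambda>r. X r $ i) s b (G i)"
    "\<And>u v. u \<in> {s..b} \<Longrightarrow> v \<in> {s..b} \<Longrightarrow> ?Y v - ?Y u = (\<Sum>i\<in>UNIV. G i v - G i u)"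
    using Y2' unfolding cde_path_def by blast
  \<comment> \<open>The primitives of the two halves need not agree at \<open>s\<close>, so
    \<open>G i\<close> is shifted by a constant to continue \<open>F i\<close>.\<close>
  define H where "H = (\<lambda>i r. if r \<le> s then F i r else G i r + (F i s - G i s))"
  have "rs_primitive C (\<lambda>r. V i (?Y r)) (\<lambda>r. X r $ i) a b (H i)" for i
  proof (rule rs_primitive_join)
    show "rs_primitive C (\<lambda>r. V i (?Y r)) (\<lambda>r. X r $ i) a s (H i)"
      by (rule rs_primitive_cong[OF F(2), where k = 0]) (auto simp: H_def)
    show "rs_primitive C (\<lambda>r. V i (?Y r)) (\<lambda>r. X r $ i) s b (H i)"
      by (rule rs_primitive_cong[OF G(2), where k = "F i s - G i s"]) (auto simp: H_def)
  qed
  \<comment> \<open>Comparing with time \<open>s\<close> only involves one half at a time; the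
    increment between arbitrary \<open>u\<close> and \<open>v\<close> follows by
    subtraction.\<close>
  moreover have from_s: "?Y v - ?Y s = (\<Sum>i\<in>UNIV. H i v - H i s)" if "v \<in> {a..b}" for v
  proof (cases "v \<le> s")
    case True
    then show ?thesis using F(3)[of s v] that s by (simp add: H_def)
  next
    case False
    then show ?thesis using G(3)[of s v] that s by (simp add: H_def)
  qed
  then have "?Y v - ?Y u = (\<Sum>i\<in>UNIV. H i v - H i u)" if "u \<in> {a..b}" "v \<in> {a..b}" for u v
    using from_s[OF that(1)] from_s[OF that(2)] unfolding sum_subtractf
    by (metis (no_types, lifting) diff_diff_eq2 diff_add_cancel)
  moreover have "continuous_on ({a..s} \<union> {s..b}) ?Y"
    by (intro continuous_on_closed_Un F(1) G(1)) auto
  moreover have "{a..s} \<union> {s..b} = {a..b}" using s by auto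
  ultimately show ?thesis unfolding cde_path_def by (intro conjI exI[of _ H]) auto
qed

text \<open>Solvability is assumed only with data at time 0. The equation is therefore solved from
  \<open>z\<close> once along the path run backwards from \<open>s\<close> and once along the path
  run forwards from \<open>s\<close>; the first solution is reversed, the second shifted, and both
  are glued at \<open>s\<close>.\<close>

lemma cde_solution_through_point:
  assumes "0 \<le> T" and V: "\<And>i. continuous_on UNIV (V i)"
    and X: "C-lipschitz_on {0..T} X"
    and ex: "\<And>Z y. lipschitz_path T Z \<Longrightarrow> \<exists>Y. cde_solution V T Z y Y"
    and s: "s \<in> {0..T}"
  obtains Y where "cde_path V C X 0 T Y" "Y s = z"
proof -
  \<comment> \<open>A 1-Lipschitz time change of \<open>{0..T}\<close> into itself preserves the
    Lipschitz constant \<open>C\<close>, so the existence hypothesis applies to the reparametrized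
    path.\<close>
  have solve: "\<exists>U. cde_path V C (\<lambda>r. X (\<phi> r)) 0 T U \<and> U 0 = z"
    if \<phi>: "1-lipschitz_on {0..T} \<phi>" "\<phi> ` {0..T} \<subseteq> {0..T}" for \<phi>
  proof -
    have "C-lipschitz_on {0..T} (X \<circ> \<phi>)"
      using lipschitz_on_compose[OF \<phi>(1) lipschitz_on_subset[OF X \<phi>(2)]] by simp
    then have L: "C-lipschitz_on {0..T} (\<lambda>r. X (\<phi> r))" by (simp add: o_def)
    then have "lipschitz_path T (\<lambda>r. X (\<phi> r))" unfolding lipschitz_path_def by blast
    then obtain U where "cde_solution V T (\<lambda>r. X (\<phi> r)) z U" using ex by blast
    then show ?thesis
      using cde_solution_iff_cde_path[where V = V, OF L V \<open>0 \<le> T\<close>] by blast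
  qed
  \<comment> \<open>Clamping freezes the path once it reaches an end of \<open>{0..T}\<close>, since
    the equations have to be posed on the whole interval. Only the unclamped pieces, on
    \<open>{0..s}\<close> and \<open>{0..T - s}\<close>, are kept.\<close>
  have "1-lipschitz_on {0..T} (\<lambda>r. max (s - r) 0)" "1-lipschitz_on {0..T} (\<lambda>r. min (s + r) T)"
    by (auto intro!: lipschitz_onI simp: dist_real_def)
  then obtain U1 U2 where
    U1: "cde_path V C (\<lambda>r. X (max (s - r) 0)) 0 T U1" "U1 0 = z" and
    U2: "cde_path V C (\<lambda>r. X (min (s + r) T)) 0 T U2" "U2 0 = z"
    using solve[of "\<lambda>r. max (s - r) 0"] solve[of "\<lambda>r. min (s + r) T"] s by force
  have "cde_path V C (\<lambda>r. X (max (s - r) 0)) 0 s U1"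
    using cde_path_subset[OF U1(1)] s by simp
  from cde_path_reverse[OF this, of s]
  have 1: "cde_path V C X 0 s (\<lambda>r. U1 (s - r))"
    by (intro cde_path_cong[where X' = X, rotated]) auto
  have "cde_path V C (\<lambda>r. X (min (s + r) T)) 0 (T - s) U2"
    using cde_path_subset[OF U2(1)] s by simp
  from cde_path_shift[OF this, of s]
  have 2: "cde_path V C X s T (\<lambda>r. U2 (r - s))"
    by (intro cde_path_cong[where X' = X, rotated]) auto
  have "cde_path V C X 0 T (\<lambda>r. if r \<le> s then U1 (s - r) else U2 (r - s))"
    using cde_path_join[OF 1 2] s U1(2) U2(2) by simp
  then show ?thesis by (rule that) (use U1(2) in simp)
qed

section \<open>Recovering the increments of the path\<close>

text \<open>Both equations express the same increment of \<open>Y\<close>. Freezing each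
  \<open>V i\<close> at \<open>Y s\<close> in both and subtracting leaves an error of order
  \<open>\<omega>\<close> times the elapsed time, where \<open>\<omega>\<close> bounds the
  oscillation of the \<open>V i\<close> along \<open>Y\<close> and tends to 0 near
  \<open>s\<close>.\<close>

lemma cde_path_difference_has_derivative_zero:
  assumes Y: "cde_path V C X 0 T Y" and Y': "cde_path V C' X' 0 T Y"
    and V: "\<And>i. continuous_on UNIV (V i)" and s: "s \<in> {0..T}"
    and "0 \<le> C" "0 \<le> C'"
  shows "((\<lambda>t. \<Sum>i\<in>UNIV. (X t $ i - X' t $ i) *\<^sub>R V i (Y s)) has_derivative (\<lambda>_. 0))
    (at s within {0..T})"
proof -
  obtain F where cont: "continuous_on {0..T} Y"
    and F: "\<And>i. rs_primitive C (\<lambda>r. V i (Y r)) (\<lambda>r. X r $ i) 0 T (F i)"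
    and YF: "\<And>u v. u \<in> {0..T} \<Longrightarrow> v \<in> {0..T} \<Longrightarrow> Y v - Y u = (\<Sum>i\<in>UNIV. F i v - F i u)"
    using Y unfolding cde_path_def by blast
  obtain G where G: "\<And>i. rs_primitive C' (\<lambda>r. V i (Y r)) (\<lambda>r. X' r $ i) 0 T (G i)"
    and YG: "\<And>u v. u \<in> {0..T} \<Longrightarrow> v \<in> {0..T} \<Longrightarrow> Y v - Y u = (\<Sum>i\<in>UNIV. G i v - G i u)"
    using Y' unfolding cde_path_def by blast
  define W where "W = (\<lambda>i t. X t $ i - X' t $ i)"
  \<comment> \<open>Each letter contributes an error with factor \<open>C\<close> from the first
    equation and \<open>C'\<close> from the second.\<close>
  define A where "A = real CARD('a) * (C + C')"
  have "A \<ge> 0" using assms by (simp add: A_def)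
  have bound: "norm (\<Sum>i\<in>UNIV. (W i v - W i u) *\<^sub>R V i (Y s)) \<le> A * (v - u) * \<omega>"
    if uv: "0 \<le> u" "u \<le> v" "v \<le> T"
      and \<omega>: "\<And>i y. u \<le> y \<Longrightarrow> y \<le> v \<Longrightarrow> norm (V i (Y y) - V i (Y s)) \<le> \<omega>" for u v \<omega>
  proof -
    let ?f = "\<lambda>i. F i v - F i u - (X v $ i - X u $ i) *\<^sub>R V i (Y s)"
    let ?g = "\<lambda>i. G i v - G i u - (X' v $ i - X' u $ i) *\<^sub>R V i (Y s)"
    have "(\<Sum>i\<in>UNIV. F i v - F i u) = (\<Sum>i\<in>UNIV. G i v - G i u)"
      using YF[of u v] YG[of u v] uv by simp
    then have "(\<Sum>i\<in>UNIV. (W i v - W i u) *\<^sub>R V i (Y s)) = (\<Sum>i\<in>UNIV. ?g i - ?f i)"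
      unfolding W_def by (simp add: sum_subtractf sum.distrib algebra_simps)
    also have "norm \<dots> \<le> (\<Sum>i\<in>(UNIV::'a set). (C + C') * (v - u) * \<omega>)"
    proof (rule sum_norm_le)
      fix i
      have "norm (?f i) \<le> C * (v - u) * \<omega>" using uv \<omega> by (intro rs_primitiveD[OF F])
      moreover have "norm (?g i) \<le> C' * (v - u) * \<omega>" using uv \<omega> by (intro rs_primitiveD[OF G])
      ultimately show "norm (?g i - ?f i) \<le> (C + C') * (v - u) * \<omega>"
        using norm_triangle_ineq4[of "?g i" "?f i"] by (simp add: algebra_simps)
    qed
    finally show ?thesis by (simp add: A_def mult_ac)
  qed
  show ?thesis
    unfolding has_derivative_within_alt
  proof (intro conjI allI impI bounded_linear_zero)
    fix e :: real assume "e > 0"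
    define \<omega> where "\<omega> = e / (A + 1)"
    have "\<omega> > 0" using \<open>e > 0\<close> \<open>A \<ge> 0\<close> by (simp add: \<omega>_def)
    have "\<exists>d>0. \<forall>y\<in>{0..T}. dist y s < d \<longrightarrow> dist (V i (Y y)) (V i (Y s)) < \<omega>" for i
    proof -
      have "continuous_on {0..T} (\<lambda>r. V i (Y r))"
        using cont by (intro continuous_on_compose2[OF V]) auto
      then show ?thesis using s \<open>\<omega> > 0\<close> unfolding continuous_on_iff by blast
    qed
    then obtain d where d: "\<And>i. d i > 0"
      "\<And>i y. y \<in> {0..T} \<Longrightarrow> dist y s < d i \<Longrightarrow> dist (V i (Y y)) (V i (Y s)) < \<omega>"
      by metis
    \<comment> \<open>Finiteness of the alphabet gives one radius for all letters.\<close>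
    define \<delta> where "\<delta> = Min (range d)"
    have \<delta>: "\<delta> > 0" "\<And>i. \<delta> \<le> d i" using d(1) by (auto simp: \<delta>_def)
    have "norm ((\<Sum>i\<in>UNIV. W i t *\<^sub>R V i (Y s)) - (\<Sum>i\<in>UNIV. W i s *\<^sub>R V i (Y s)) - 0)
        \<le> e * norm (t - s)" if t: "t \<in> {0..T}" "norm (t - s) < \<delta>" for t
    proof -
      have near: "norm (V i (Y y) - V i (Y s)) \<le> \<omega>" if "min s t \<le> y" "y \<le> max s t" for i y
      proof -
        have "dist y s < d i" "y \<in> {0..T}"
          using that t s \<delta>(2)[of i] by (auto simp: dist_real_def min_def max_def split: if_splits)
        then show ?thesis using d(2) by (simp add: dist_norm less_imp_le)
      qed
      \<comment> \<open>\<open>bound\<close> requires ordered endpoints; \<open>min\<close> and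
        \<open>max\<close> treat \<open>t\<close> on either side of \<open>s\<close>
        together.\<close>
      have "norm (\<Sum>i\<in>UNIV. (W i (max s t) - W i (min s t)) *\<^sub>R V i (Y s))
          \<le> A * (max s t - min s t) * \<omega>"
        using t s near by (intro bound) auto
      also have "max s t - min s t = norm (t - s)" by (auto simp: max_def min_def)
      also have "A * norm (t - s) * \<omega> \<le> e * norm (t - s)"
      proof -
        have "A * \<omega> \<le> e" using \<open>e > 0\<close> \<open>A \<ge> 0\<close> by (simp add: \<omega>_def field_simps)
        then show ?thesis using mult_right_mono[of "A * \<omega>" e "norm (t - s)"] by (simp add: mult_ac)
      qed
      also have "norm (\<Sum>i\<in>UNIV. (W i (max s t) - W i (min s t)) *\<^sub>R V i (Y s))
          = norm (\<Sum>i\<in>UNIV. (W i t - W i s) *\<^sub>R V i (Y s))"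
      proof (cases "s \<le> t")
        case False
        have "(\<Sum>i\<in>UNIV. (W i s - W i t) *\<^sub>R V i (Y s))
            = - (\<Sum>i\<in>UNIV. (W i t - W i s) *\<^sub>R V i (Y s))"
          by (simp add: sum_negf[symmetric] scaleR_minus_left[symmetric] del: scaleR_minus_left)
        then show ?thesis using False by (simp add: max_def min_def)
      qed simp
      finally show ?thesis by (simp add: scaleR_diff_left sum_subtractf)
    qed
    then show "\<exists>d>0. \<forall>t\<in>{0..T}. norm (t - s) < d \<longrightarrow>
        norm ((\<Sum>i\<in>UNIV. (X t $ i - X' t $ i) *\<^sub>R V i (Y s)) -
          (\<Sum>i\<in>UNIV. (X s $ i - X' s $ i) *\<^sub>R V i (Y s)) - 0) \<le> e * norm (t - s)"
      using \<delta>(1) unfolding W_def by blast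
  qed
qed

section \<open>From independence at level one to iterated integrals\<close>

text \<open>The one-vertex trees carry the fields \<open>V i\<close>, and they are pairwise
  non-isomorphic because an isomorphism preserves the letter at the root.\<close>

lemma tree_fields_independent_1D:
  assumes ind: "tree_fields_independent V 1" and zero: "\<And>x. (\<Sum>i\<in>UNIV. c i *\<^sub>R V i x) = 0"
  shows "c i = 0"
proof -
  \<comment> \<open>A one-letter word has no non-root vertex, so the extensional parent map is
    \<open>undefined\<close> everywhere.\<close>
  define \<tau> where "\<tau> = (\<lambda>i::'a. ([i], \<lambda>l::nat. undefined :: nat))"
  have inj: "inj \<tau>" by (auto simp: \<tau>_def inj_def)
  have field: "recursive_tree_field V (\<tau> i) = V i" for i
    by (simp add: recursive_tree_field_def \<tau>_def subtree_at.simps letter_def tree_field_single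
        del: tree_field.simps)
  have "range \<tau> \<subseteq> (\<Union>w\<in>{w. length w = 1}. recursive_trees w)"
    by (auto simp: recursive_trees_def \<tau>_def)
  moreover have "pairwise (\<lambda>\<tau> \<tau>'. \<not> tree_iso \<tau> \<tau>') (range \<tau>)"
    by (auto simp: pairwise_def tree_iso_def letter_def \<tau>_def)
  moreover have "(\<Sum>t\<in>range \<tau>. c (inv \<tau> t) *\<^sub>R recursive_tree_field V t x) = 0" for x
    using zero by (simp add: sum.reindex[OF inj] inj field)
  ultimately have "\<forall>t\<in>range \<tau>. c (inv \<tau> t) = 0"
    using ind[unfolded tree_fields_independent_def, rule_format,
        of "range \<tau>" "\<lambda>t. c (inv \<tau> t)"] by blast
  then show ?thesis by (metis inj inv_f_f rangeI)
qed

text \<open>The two integrals at each level have the same candidate values \<open>I\<close>, so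
  their definite descriptions agree without any proof that the integrals exist. The induction needs
  every upper limit \<open>t'\<close> up to \<open>t\<close>, since the inner integrals form the
  next integrand.\<close>

lemma iterated_integral_rev_cong:
  assumes "\<And>r. r \<in> {s..t} \<Longrightarrow> X r = X' r + k" and "t' \<le> t"
  shows "iterated_integral_rev X s w t' = iterated_integral_rev X' s w t'"
  using assms(2)
proof (induction w arbitrary: t')
  case (Cons i w)
  have "has_rs_integral (iterated_integral_rev X s w) (\<lambda>r. X r $ i) s t' I
      = has_rs_integral (iterated_integral_rev X' s w) (\<lambda>r. X' r $ i) s t' I" for I
    using Cons assms(1) by (intro has_rs_integral_cong[where k = "k $ i"]) auto
  then show ?case by (simp add: rs_integral_def)
qed simp

theorem theorem4p1:
  fixes V :: "'d::finite \<Rightarrow> real ^ 'n::finite \<Rightarrow> real ^ 'n"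
    and T :: real and L :: nat
    and X X' :: "real \<Rightarrow> real ^ 'd"
  assumes "T > 0"
    and "\<forall>i. smooth_field (V i)"
    and "\<forall>m. 1 \<le> m \<and> m \<le> L \<longrightarrow> tree_fields_independent V m"
    and "\<forall>Z y. lipschitz_path T Z \<longrightarrow> cde_uniquely_solvable V T Z y"
    and "lipschitz_path T X" and "lipschitz_path T X'"
    and "\<forall>y Y Y'. cde_solution V T X y Y \<and> cde_solution V T X' y Y' \<longrightarrow>
           (\<forall>t\<in>{0..T}. Y t = Y' t)"
  shows "\<forall>m\<le>L. \<forall>w. length w = m \<longrightarrow>
           (\<forall>s t. 0 \<le> s \<and> s \<le> t \<and> t \<le> T \<longrightarrow>
              iterated_integral X w s t = iterated_integral X' w s t)"
proof (cases "L = 0")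
  case True
  then show ?thesis by (simp add: iterated_integral_def)
next
  case False
  have "T \<ge> 0" using \<open>T > 0\<close> by simp
  have V: "continuous_on UNIV (V i)" for i
    using assms(2)[rule_format, of i, unfolded smooth_field_def, rule_format, of "[]"]
    by (simp add: iterated_partial_def differentiable_imp_continuous_on)
  have ex: "\<exists>Y. cde_solution V T Z y Y" if "lipschitz_path T Z" for Z y
    using assms(4) that unfolding cde_uniquely_solvable_def by blast
  obtain C where C: "C-lipschitz_on {0..T} X" using assms(5) by (auto simp: lipschitz_path_def)
  obtain C' where C': "C'-lipschitz_on {0..T} X'" using assms(6) by (auto simp: lipschitz_path_def)
  note sol = cde_solution_iff_cde_path[where V = V, OF C V \<open>T \<ge> 0\<close>]
  note sol' = cde_solution_iff_cde_path[where V = V, OF C' V \<open>T \<ge> 0\<close>]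
  have deriv: "((\<lambda>t. \<Sum>i\<in>UNIV. (X t $ i - X' t $ i) *\<^sub>R V i z) has_derivative (\<lambda>_. 0))
      (at s within {0..T})" if s: "s \<in> {0..T}" for s z
  proof -
    obtain Y where Y: "cde_path V C X 0 T Y" "Y s = z"
      using cde_solution_through_point[where V = V, OF \<open>T \<ge> 0\<close> V C ex s] .
    \<comment> \<open>The solution of the second equation with the same initial value coincides with
      \<open>Y\<close> by hypothesis, so \<open>Y\<close> solves both equations and still passes
      through \<open>z\<close> at time \<open>s\<close>.\<close>
    obtain Y' where Y': "cde_path V C' X' 0 T Y'" "Y' 0 = Y 0"
      using ex[OF assms(6)] sol' by blast
    have "Y t = Y' t" if "t \<in> {0..T}" for t
      using assms(7) Y(1) Y' sol sol' that by blast
    then have "cde_path V C' X' 0 T Y" using cde_path_cong[OF Y'(1)] by blast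
    from cde_path_difference_has_derivative_zero[where V = V, OF Y(1) this V s lipschitz_on_nonneg[OF C]
        lipschitz_on_nonneg[OF C']]
    show ?thesis by (simp add: Y(2))
  qed
  define W where "W = (\<lambda>t. X t - X' t)"
  have const: "W t = W 0" if t: "t \<in> {0..T}" for t
  proof -
    \<comment> \<open>Here \<open>z\<close> is fixed while time varies over \<open>{0..T}\<close>,
      so the vanishing derivative gives a constant for each \<open>z\<close>; independence then uses
      all \<open>z\<close> at once.\<close>
    have "(\<Sum>i\<in>UNIV. (W t $ i - W 0 $ i) *\<^sub>R V i z) = 0" for z
    proof -
      obtain c where "\<And>t. t \<in> {0..T} \<Longrightarrow> (\<Sum>i\<in>UNIV. (X t $ i - X' t $ i) *\<^sub>R V i z) = c"
        using has_derivative_zero_constant[OF convex_closed_interval deriv] by blast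
      from this[OF t] this[of 0] \<open>T \<ge> 0\<close> show ?thesis
        by (simp add: W_def sum_subtractf scaleR_diff_left)
    qed
    moreover have "tree_fields_independent V 1" using assms(3) False by simp
    ultimately have "W t $ i - W 0 $ i = 0" for i by (intro tree_fields_independent_1D)
    then show ?thesis by (simp add: vec_eq_iff)
  qed
  have X: "X r = X' r + W 0" if "r \<in> {0..T}" for r
    using const[OF that] by (simp add: W_def algebra_simps)
  have "iterated_integral X w s t = iterated_integral X' w s t"
    if "0 \<le> s" "t \<le> T" for w s t
    unfolding iterated_integral_def
    by (rule iterated_integral_rev_cong[where t = t and k = "W 0"]) (use that X in auto)
  then show ?thesis by blast
qed

end
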